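(* Let $T$ and $T'$ be two $(\leq 3)$-hypomorphic tournaments on the same set $V$ of $v$ vertices. Let $p$ be a prime number and $k$ an integer with $4\leq k\leq v-4$. 1) If $d^+_4(T_{\restriction K})=d^+_4(T'_{\restriction K})$ for all $k$-element subsets $K$ of $V$, then $T'$ and $T$ are $(\leq 5)$-hypomorphic. 2) Assume $d^+_4(T_{\restriction K})\equiv d^+_4(T'_{\restriction K}) \pmod p$ for all $k$-element subsets $K$ of $V$. a) If $p\geq 5$ and $k\not\equiv 1,2,3\pmod p$, then $T'$ and $T$ are $(\leq 5)$-hypomorphic. b) If ($p=3$, $3\mid k-1$ and $9\nmid k-1$) or ($p=2$, $4\mid k$ and $8\nmid k$), then $T'$ and $T$ are $(\leq 5)$-hypomorphic. c) If $p=2$ and $8\mid k$, then either $T'$ and $T$ are $(\leq 5)$-hypomorphic, or for every $4$-element subset $S$ of $V$, $T_{\restriction S}$ is isomorphic to $\delta^+$ if and only if $T'_{\restriction S}$ is isomorphic to $\delta^-$.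
   Context: Tournaments: for distinct vertices $x,y$ exactly one of the arcs $(x,y),(y,x)$ is present; $x\to y$ means $(x,y)$ is an arc. The dual $T^*$ reverses all arcs. $T_{\restriction K}$ is the induced subtournament on $K$. $\delta^+$ is the tournament on $\{0,1,2,3\}$ with arcs $0\to1$, $1\to2$, $2\to0$ and $0\to3$, $1\to3$, $2\to3$; $\delta^-=(\delta^+)^*$. $d^+_4(T)$ is the number of $4$-element vertex subsets $S$ with $T_{\restriction S}\simeq\delta^+$. Tournaments $T,T'$ on the same set $V$ are $h$-hypomorphic if for every $h$-element subset $K$ of $V$, $T_{\restriction K}\simeq T'_{\restriction K}$; they are $(\leq k)$-hypomorphic if they are $h$-hypomorphic for every $h\leq k$. *)

theory Defs
  imports
    "Graph_Theory.Pair_Digraph"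
    "Graph_Theory.Digraph_Isomorphism"
    "HOL-Number_Theory.Cong"
begin

(* Finiteness of the vertex set and absence of loops come from pair_digraph. *)
locale tournament = pair_digraph T for T :: "'a pair_pre_digraph" +
  assumes one_arc:
    "\<lbrakk>x \<in> pverts T; y \<in> pverts T; x \<noteq> y\<rbrakk> \<Longrightarrow> (x, y) \<in> parcs T \<longleftrightarrow> (y, x) \<notin> parcs T"

definition dual :: "'a pair_pre_digraph \<Rightarrow> 'a pair_pre_digraph" where
  "dual T = \<lparr> pverts = pverts T, parcs = (parcs T)\<inverse> \<rparr>"

definition delta_plus :: "nat pair_pre_digraph" where
  "delta_plus = \<lparr> pverts = {0, 1, 2, 3},
     parcs = {(0, 1), (1, 2), (2, 0), (0, 3), (1, 3), (2, 3)} \<rparr>"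

definition delta_minus :: "nat pair_pre_digraph" where
  "delta_minus = dual delta_plus"

(* Defined for general digraphs because the induced subdigraph operation of the library
   returns a pre_digraph. *)
definition d4_plus :: "('a, 'b) pre_digraph \<Rightarrow> nat" where
  "d4_plus G = card {S. S \<subseteq> verts G \<and> card S = 4 \<and> digraph_iso (G \<restriction> S) (with_proj delta_plus)}"

definition hypomorphic :: "nat \<Rightarrow> 'a pair_pre_digraph \<Rightarrow> 'a pair_pre_digraph \<Rightarrow> bool" where
  "hypomorphic h T T' \<longleftrightarrow> pverts T = pverts T' \<and>
     (\<forall>K. K \<subseteq> pverts T \<and> card K = h \<longrightarrow> digraph_iso (with_proj T \<restriction> K) (with_proj T' \<restriction> K))"

definition upto_hypomorphic :: "nat \<Rightarrow> 'a pair_pre_digraph \<Rightarrow> 'a pair_pre_digraph \<Rightarrow> bool" where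
  "upto_hypomorphic k T T' \<longleftrightarrow> (\<forall>h\<le>k. hypomorphic h T T')"

(* The library's digraph_iso also maps arcs; on digraphs whose arcs are pairs it is the usual
   notion of an arc-preserving and arc-reflecting bijection of vertices. *)
lemma digraph_iso_with_proj_iff:
  "digraph_iso (with_proj T \<restriction> K) (with_proj T' \<restriction> L) \<longleftrightarrow>
     (\<exists>f. bij_betw f K L \<and> (\<forall>x\<in>K. \<forall>y\<in>K. (x, y) \<in> parcs T \<longleftrightarrow> (f x, f y) \<in> parcs T'))"
  (is "?L \<longleftrightarrow> ?R")
proof
  assume ?L
  then obtain h where h: "pre_digraph.digraph_isomorphism (with_proj T \<restriction> K) h"
    and eq: "with_proj T' \<restriction> L = app_iso h (with_proj T \<restriction> K)"
    unfolding digraph_iso_def by blast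
  let ?f = "iso_verts h"
  have ft: "iso_tail h = fst" "iso_head h = snd"
    using arg_cong[OF eq, of tail] arg_cong[OF eq, of head] by auto
  have inj: "inj_on ?f K" and L: "L = ?f ` K"
    using h arg_cong[OF eq, of verts] by (auto simp: pre_digraph.digraph_isomorphism_def)
  have ia: "iso_arcs h e = (?f (fst e), ?f (snd e))"
    if "e \<in> parcs T" "fst e \<in> K" "snd e \<in> K" for e
    using h that ft by (cases e) (auto simp: pre_digraph.digraph_isomorphism_def intro!: prod_eqI)
  have arcs: "{e \<in> parcs T'. fst e \<in> L \<and> snd e \<in> L} =
      (\<lambda>e. (?f (fst e), ?f (snd e))) ` {e \<in> parcs T. fst e \<in> K \<and> snd e \<in> K}"
    using arg_cong[OF eq, of arcs] ia by (simp cong: image_cong_simp)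
  have "(x, y) \<in> parcs T \<longleftrightarrow> (?f x, ?f y) \<in> parcs T'" if "x \<in> K" "y \<in> K" for x y
  proof
    assume "(x, y) \<in> parcs T"
    then have "(?f x, ?f y) \<in> (\<lambda>e. (?f (fst e), ?f (snd e))) ` {e \<in> parcs T. fst e \<in> K \<and> snd e \<in> K}"
      using that by force
    then show "(?f x, ?f y) \<in> parcs T'" unfolding arcs[symmetric] by simp
  next
    assume "(?f x, ?f y) \<in> parcs T'"
    then have "(?f x, ?f y) \<in> {e \<in> parcs T'. fst e \<in> L \<and> snd e \<in> L}" using that L by auto
    then obtain a b where ab: "(a, b) \<in> parcs T" "a \<in> K" "b \<in> K" "?f x = ?f a" "?f y = ?f b"
      unfolding arcs by auto
    then have "x = a" "y = b" using that inj by (metis inj_onD)+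
    then show "(x, y) \<in> parcs T" using ab by simp
  qed
  then show ?R using inj L by (auto simp: bij_betw_def)
next
  assume ?R
  then obtain f where inj: "inj_on f K" and L: "L = f ` K"
    and f: "\<And>x y. x \<in> K \<Longrightarrow> y \<in> K \<Longrightarrow> (x, y) \<in> parcs T \<longleftrightarrow> (f x, f y) \<in> parcs T'"
    unfolding bij_betw_def by blast
  let ?h = "\<lparr> iso_verts = f, iso_arcs = map_prod f f, iso_head = snd, iso_tail = fst \<rparr>"
  have "wf_digraph (with_proj T \<restriction> K)" by unfold_locales auto
  then have "pre_digraph.digraph_isomorphism (with_proj T \<restriction> K) ?h"
    using inj by (auto simp: pre_digraph.digraph_isomorphism_def inj_on_def)
  moreover have "{e \<in> parcs T'. fst e \<in> L \<and> snd e \<in> L} =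
      map_prod f f ` {e \<in> parcs T. fst e \<in> K \<and> snd e \<in> K}"
    using f L by force
  then have "with_proj T' \<restriction> L = app_iso ?h (with_proj T \<restriction> K)"
    using L by (intro pre_digraph.equality) auto
  ultimately show ?L unfolding digraph_iso_def by blast
qed

lemma tournament_delta_plus: "tournament delta_plus"
  by unfold_locales (auto simp: delta_plus_def)

lemma tournament_dual:
  assumes "tournament T"
  shows "tournament (dual T)"
proof -
  interpret tournament T by (rule assms)
  show ?thesis
  proof unfold_locales
    fix x y
    assume "x \<in> pverts (dual T)" "y \<in> pverts (dual T)" "x \<noteq> y"
    then show "(x, y) \<in> parcs (dual T) \<longleftrightarrow> (y, x) \<notin> parcs (dual T)"
      using one_arc[of y x] by (simp add: dual_def)
  next
    fix e assume e: "e \<in> parcs (dual T)"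
    obtain a b where [simp]: "e = (a, b)" by (cases e)
    have "(b, a) \<in> parcs T" using e by (simp add: dual_def)
    then show "fst e \<in> pverts (dual T)" "snd e \<in> pverts (dual T)" "fst e \<noteq> snd e"
      using in_arcsD1[of b a] in_arcsD2[of b a] no_loops'[of b a] by (auto simp: dual_def)
  qed (simp_all add: dual_def)
qed

end

theory Submission
  imports Defs
begin

text \<open>
  Let \<open>f S = [T S is a \<delta>\<^sup>+] - [T' S is a \<delta>\<^sup>+]\<close> on 4-subsets. Its sums over the 4-subsets of every
  \<open>k\<close>-subset vanish modulo \<open>p\<close>. Passing to \<open>S \<mapsto> f (S \<union> {x}) - f (S \<union> {y})\<close> lowers 4 and \<open>k\<close> by
  one each, and by induction such a function is constant modulo \<open>p\<close>; the constant of the difference is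
  killed because \<open>p\<close> does not divide the binomial coefficients \<open>(k - i) choose (4 - i)\<close>,
  \<open>1 \<le> i \<le> 4\<close>, so \<open>f\<close> itself is constant modulo \<open>p\<close>. A \<open>\<delta>\<^sup>+\<close> contains exactly one 3-cycle and
  the 3-cycles of \<open>T\<close> and \<open>T'\<close> are the same, so if every 4-subset were a \<open>\<delta>\<^sup>+\<close> in \<open>T\<close> or \<open>T'\<close>, double counting
  on five points would make 5 even. Hence \<open>f\<close> vanishes somewhere, thus everywhere. This also covers
  \<open>p = 2\<close>, \<open>8 dvd k\<close>, where the second alternative is never needed; equality over the integers
  follows by taking a prime larger than \<open>k + 1\<close>. Finally, the 3-cycles and the positions of the \<open>\<delta>\<^sup>+\<close>
  determine a tournament on at most five vertices up to isomorphism.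
\<close>

section \<open>Tournaments on five vertices\<close>

datatype vtx = V0 | V1 | V2 | V3 | V4

definition cyc3 :: "bool \<Rightarrow> bool \<Rightarrow> bool \<Rightarrow> bool" where
  "cyc3 ab ac bc \<longleftrightarrow> ab \<and> bc \<and> \<not> ac \<or> \<not> ab \<and> \<not> bc \<and> ac"

text \<open>\<open>delta_plus\<close> in bits: the four disjuncts take the last, third, second and
  first vertex in turn as the sink of a 3-cycle on the other three.\<close>

definition sink4 :: "bool \<Rightarrow> bool \<Rightarrow> bool \<Rightarrow> bool \<Rightarrow> bool \<Rightarrow> bool \<Rightarrow> bool" where
  "sink4 ab ac bc ad bd cd \<longleftrightarrow>
    ad \<and> bd \<and> cd \<and> cyc3 ab ac bc \<or> ac \<and> bc \<and> \<not> cd \<and> cyc3 ab ad bd \<or>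
    ab \<and> \<not> bc \<and> \<not> bd \<and> cyc3 ac ad cd \<or> \<not> ab \<and> \<not> ac \<and> \<not> ad \<and> cyc3 bc bd cd"

text \<open>The bit \<open>ab\<close> says that the arc between the first two vertices starts at the first one, etc.\<close>

fun adj ::
  "bool \<Rightarrow> bool \<Rightarrow> bool \<Rightarrow> bool \<Rightarrow> bool \<Rightarrow> bool \<Rightarrow> bool \<Rightarrow> bool \<Rightarrow> bool \<Rightarrow> bool \<Rightarrow>
    vtx \<Rightarrow> vtx \<Rightarrow> bool" where
  "adj ab ac bc ad bd cd ae be ce de x y =
    (case x of
       V0 \<Rightarrow> (case y of V0 \<Rightarrow> False | V1 \<Rightarrow> ab | V2 \<Rightarrow> ac | V3 \<Rightarrow> ad | V4 \<Rightarrow> ae)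
     | V1 \<Rightarrow> (case y of V0 \<Rightarrow> \<not> ab | V1 \<Rightarrow> False | V2 \<Rightarrow> bc | V3 \<Rightarrow> bd | V4 \<Rightarrow> be)
     | V2 \<Rightarrow> (case y of V0 \<Rightarrow> \<not> ac | V1 \<Rightarrow> \<not> bc | V2 \<Rightarrow> False | V3 \<Rightarrow> cd | V4 \<Rightarrow> ce)
     | V3 \<Rightarrow> (case y of V0 \<Rightarrow> \<not> ad | V1 \<Rightarrow> \<not> bd | V2 \<Rightarrow> \<not> cd | V3 \<Rightarrow> False | V4 \<Rightarrow> de)
     | V4 \<Rightarrow> (case y of V0 \<Rightarrow> \<not> ae | V1 \<Rightarrow> \<not> be | V2 \<Rightarrow> \<not> ce | V3 \<Rightarrow> \<not> de | V4 \<Rightarrow> False))"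

definition agree :: "(vtx \<Rightarrow> vtx \<Rightarrow> bool) \<Rightarrow> (vtx \<Rightarrow> vtx \<Rightarrow> bool) \<Rightarrow> vtx \<Rightarrow> vtx \<Rightarrow> vtx \<Rightarrow> vtx \<Rightarrow> bool" where
  "agree r s x y x' y' \<longleftrightarrow> r x y = s x' y' \<and> r y x = s y' x'"

text \<open>An executable backtracking search for the images \<open>a\<close> to \<open>e\<close> of
  \<open>V0\<close> to \<open>V4\<close>. Since \<open>agree\<close> compares both directions of a
  pair, distinct vertices of a tournament \<open>r\<close> get distinct images.\<close>

definition iso5 :: "(vtx \<Rightarrow> vtx \<Rightarrow> bool) \<Rightarrow> (vtx \<Rightarrow> vtx \<Rightarrow> bool) \<Rightarrow> bool" where
  "iso5 r s \<longleftrightarrow> (let ex = (\<lambda>P. list_ex P [V0, V1, V2, V3, V4]) in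
    ex (\<lambda>a. ex (\<lambda>b. agree r s V0 V1 a b \<and>
      ex (\<lambda>c. agree r s V0 V2 a c \<and> agree r s V1 V2 b c \<and>
      ex (\<lambda>d. agree r s V0 V3 a d \<and> agree r s V1 V3 b d \<and> agree r s V2 V3 c d \<and>
      ex (\<lambda>e. agree r s V0 V4 a e \<and> agree r s V1 V4 b e \<and> agree r s V2 V4 c e \<and> agree r s V3 V4 d e))))))"

text \<open>
  The first tournament contains the path from \<open>V0\<close> to \<open>V4\<close> through all vertices in order; the second one
  is arbitrary. Constraints are tested as soon as their bits are chosen, and written with \<open>\<or>\<close>
  instead of \<open>\<longrightarrow>\<close>, since code equations evaluate \<open>\<or>\<close> lazily: this keeps the enumeration small.
\<close>

definition path5_determined :: "bool \<Rightarrow> bool \<Rightarrow> bool \<Rightarrow> bool \<Rightarrow> bool \<Rightarrow> bool \<Rightarrow> bool" where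
 "path5_determined ac ad bd ae be ce \<longleftrightarrow> (let all = (\<lambda>P. list_all P [True, False]) in
   all (\<lambda>ab'. all (\<lambda>ac'. all (\<lambda>bc'.
   cyc3 True ac True \<noteq> cyc3 ab' ac' bc' \<or>
   all (\<lambda>ad'. all (\<lambda>bd'. cyc3 True ad bd \<noteq> cyc3 ab' ad' bd' \<or>
   all (\<lambda>cd'. cyc3 ac ad True \<noteq> cyc3 ac' ad' cd' \<or> cyc3 True bd True \<noteq> cyc3 bc' bd' cd' \<or>
      sink4 True ac True ad bd True \<noteq> sink4 ab' ac' bc' ad' bd' cd' \<or>
   all (\<lambda>ae'. all (\<lambda>be'. cyc3 True ae be \<noteq> cyc3 ab' ae' be' \<or>
   all (\<lambda>ce'. cyc3 ac ae ce \<noteq> cyc3 ac' ae' ce' \<or> cyc3 True be ce \<noteq> cyc3 bc' be' ce' \<or>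
       sink4 True ac True ae be ce \<noteq> sink4 ab' ac' bc' ae' be' ce' \<or>
   all (\<lambda>de'. cyc3 ad ae True \<noteq> cyc3 ad' ae' de' \<or> cyc3 bd be True \<noteq> cyc3 bd' be' de' \<or>
       cyc3 True ce True \<noteq> cyc3 cd' ce' de' \<or>
       sink4 True ad bd ae be True \<noteq> sink4 ab' ad' bd' ae' be' de' \<or>
       sink4 ac ad True ae ce True \<noteq> sink4 ac' ad' cd' ae' ce' de' \<or>
       sink4 True bd True be ce True \<noteq> sink4 bc' bd' cd' be' ce' de' \<or>
       iso5 (adj True ac True ad bd True ae be ce True) (adj ab' ac' bc' ad' bd' cd' ae' be' ce' de'))))))))))))"

text \<open>The path fixes four of the ten arcs of the first tournament, so 64 cases remain, each
  with a pruned search through the second tournament.\<close>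

lemma path5_determined_list_all:
  "list_all (\<lambda>ac. list_all (\<lambda>ad. list_all (\<lambda>bd. list_all (\<lambda>ae. list_all (\<lambda>be. list_all (\<lambda>ce.
     path5_determined ac ad bd ae be ce)
   [True, False]) [True, False]) [True, False]) [True, False]) [True, False]) [True, False]"
  by code_simp

lemma list_all_bool: "list_all P [True, False] \<longleftrightarrow> (\<forall>b. P b)"
  by (auto simp: all_bool_eq)

lemma UNIV_vtx: "UNIV = {V0, V1, V2, V3, V4}"
  by (auto, metis vtx.exhaust)

lemma list_ex_vtx: "list_ex P [V0, V1, V2, V3, V4] \<longleftrightarrow> (\<exists>x. P x)"
  by (auto, metis vtx.exhaust)

lemma path5_determined: "path5_determined ac ad bd ae be ce"
  using path5_determined_list_all unfolding list_all_bool by blast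

lemma path5_determinedD:
  assumes "path5_determined ac ad bd ae be ce"
    "cyc3 True ac True = cyc3 ab' ac' bc'" "cyc3 True ad bd = cyc3 ab' ad' bd'"
    "cyc3 ac ad True = cyc3 ac' ad' cd'" "cyc3 True bd True = cyc3 bc' bd' cd'"
    "sink4 True ac True ad bd True = sink4 ab' ac' bc' ad' bd' cd'"
    "cyc3 True ae be = cyc3 ab' ae' be'"
    "cyc3 ac ae ce = cyc3 ac' ae' ce'" "cyc3 True be ce = cyc3 bc' be' ce'"
    "sink4 True ac True ae be ce = sink4 ab' ac' bc' ae' be' ce'"
    "cyc3 ad ae True = cyc3 ad' ae' de'" "cyc3 bd be True = cyc3 bd' be' de'"
    "cyc3 True ce True = cyc3 cd' ce' de'"
    "sink4 True ad bd ae be True = sink4 ab' ad' bd' ae' be' de'"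
    "sink4 ac ad True ae ce True = sink4 ac' ad' cd' ae' ce' de'"
    "sink4 True bd True be ce True = sink4 bc' bd' cd' be' ce' de'"
  shows "iso5 (adj True ac True ad bd True ae be ce True) (adj ab' ac' bc' ad' bd' cd' ae' be' ce' de')"
proof -
  \<comment> \<open>Each constraint of the search has the form "violated, or continue". The
    equalities remove the first alternative in the order in which the search tests them; the last
    six are tested together after \<open>de'\<close>.\<close>
  have mp: "R" if "P \<noteq> Q \<or> R" "P = Q" for P Q R using that by blast
  note * = assms(1)[unfolded path5_determined_def Let_def list_all_bool, THEN spec[of _ ab'], THEN spec[of _ ac'],
    THEN spec[of _ bc'], THEN mp, OF assms(2), THEN spec[of _ ad'], THEN spec[of _ bd'],
    THEN mp, OF assms(3), THEN spec[of _ cd'], THEN mp, OF assms(4), THEN mp, OF assms(5),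
    THEN mp, OF assms(6), THEN spec[of _ ae'], THEN spec[of _ be'], THEN mp, OF assms(7),
    THEN spec[of _ ce'], THEN mp, OF assms(8), THEN mp, OF assms(9), THEN mp, OF assms(10),
    THEN spec[of _ de']]
  then show ?thesis using assms(11-16) by blast
qed

text \<open>The search compares only the ten pairs of distinct vertices; irreflexivity supplies the
  diagonal.\<close>

lemma iso5_imp:
  assumes "iso5 r s" and r: "\<And>x. \<not> r x x" and s: "\<And>x. \<not> s x x"
  shows "\<exists>f. \<forall>x y. r x y = s (f x) (f y)"
proof -
  obtain a b c d e where *: "agree r s V0 V1 a b" "agree r s V0 V2 a c" "agree r s V1 V2 b c"
    "agree r s V0 V3 a d" "agree r s V1 V3 b d" "agree r s V2 V3 c d"
    "agree r s V0 V4 a e" "agree r s V1 V4 b e" "agree r s V2 V4 c e" "agree r s V3 V4 d e"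
    using assms(1) unfolding iso5_def Let_def list_ex_vtx by blast
  let ?f = "case_vtx a b c d e"
  have "r x y = s (?f x) (?f y)" for x y
    using * r s by (cases x; cases y) (simp_all add: agree_def)
  then show ?thesis by blast
qed

section \<open>3-cycles and sunk 3-cycles of tournaments given as relations\<close>

definition tour_on :: "('a \<Rightarrow> 'a \<Rightarrow> bool) \<Rightarrow> 'a set \<Rightarrow> bool" where
  "tour_on r X \<longleftrightarrow> (\<forall>x\<in>X. \<not> r x x) \<and>
    (\<forall>x\<in>X. \<forall>y\<in>X. x \<noteq> y \<longrightarrow> (r x y \<or> r y x) \<and> \<not> (r x y \<and> r y x))"

text \<open>In a tournament the vertices below are automatically distinct.\<close>

definition has_cycle :: "('a \<Rightarrow> 'a \<Rightarrow> bool) \<Rightarrow> 'a set \<Rightarrow> bool" where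
  "has_cycle r S \<longleftrightarrow> (\<exists>a\<in>S. \<exists>b\<in>S. \<exists>c\<in>S. r a b \<and> r b c \<and> r c a)"

definition has_sunk_cycle :: "('a \<Rightarrow> 'a \<Rightarrow> bool) \<Rightarrow> 'a set \<Rightarrow> bool" where
  "has_sunk_cycle r S \<longleftrightarrow>
    (\<exists>a\<in>S. \<exists>b\<in>S. \<exists>c\<in>S. \<exists>d\<in>S. r a b \<and> r b c \<and> r c a \<and> r a d \<and> r b d \<and> r c d)"

lemma tour_on_subset: "tour_on r X \<Longrightarrow> Y \<subseteq> X \<Longrightarrow> tour_on r Y"
  unfolding tour_on_def by blast

lemma tour_on_irrefl: "tour_on r X \<Longrightarrow> x \<in> X \<Longrightarrow> \<not> r x x"
  unfolding tour_on_def by blast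

lemma tour_on_flip: "tour_on r X \<Longrightarrow> x \<in> X \<Longrightarrow> y \<in> X \<Longrightarrow> x \<noteq> y \<Longrightarrow> r y x \<longleftrightarrow> \<not> r x y"
  unfolding tour_on_def by blast

lemma has_cycle_triple:
  assumes "tour_on r {a, b, c}" "distinct [a, b, c]"
  shows "has_cycle r {a, b, c} \<longleftrightarrow> cyc3 (r a b) (r a c) (r b c)"
proof -
  have *: "\<not> r a a" "\<not> r b b" "\<not> r c c"
    "r b a = (\<not> r a b)" "r c a = (\<not> r a c)" "r c b = (\<not> r b c)"
    using assms unfolding tour_on_def by auto
  show ?thesis unfolding has_cycle_def cyc3_def
    by (cases "r a b"; cases "r a c"; cases "r b c"; simp add: *)
qed

lemma has_sunk_cycle_obtain:
  assumes "has_sunk_cycle r K" "tour_on r K"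
  obtains a b c d where "{a, b, c, d} \<subseteq> K" "distinct [a, b, c, d]"
    "r a b" "r b c" "r c a" "r a d" "r b d" "r c d"
proof -
  obtain a b c d where abc: "a \<in> K" "b \<in> K" "c \<in> K" "d \<in> K" "r a b" "r b c" "r c a" "r a d" "r b d" "r c d"
    using assms(1) unfolding has_sunk_cycle_def by blast
  then have "distinct [a, b, c, d]" using assms(2) by (auto simp: tour_on_def)
  then show thesis using that abc by auto
qed

text \<open>On four vertices a sunk cycle uses every vertex, so its last vertex is a sink of the
  whole set. This leaves only four candidates to try.\<close>

lemma has_sunk_cycle_iff_sink:
  assumes "tour_on r S" "card S = 4"
  shows "has_sunk_cycle r S \<longleftrightarrow> (\<exists>z\<in>S. (\<forall>x\<in>S - {z}. r x z) \<and> has_cycle r (S - {z}))"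
proof
  assume "has_sunk_cycle r S"
  then obtain a b c d where abcd: "{a, b, c, d} \<subseteq> S" "distinct [a, b, c, d]"
    "r a b" "r b c" "r c a" "r a d" "r b d" "r c d"
    by (rule has_sunk_cycle_obtain[OF _ assms(1)])
  moreover have "finite S" using assms(2) by (simp add: card_ge_0_finite)
  moreover have "card {a, b, c, d} = 4" using abcd(2) by simp
  ultimately have "S = {a, b, c, d}" using assms(2) by (metis card_subset_eq)
  then have "S - {d} = {a, b, c}" "d \<in> S" using abcd(2) by auto
  then show "\<exists>z\<in>S. (\<forall>x\<in>S - {z}. r x z) \<and> has_cycle r (S - {z})"
    using abcd by (intro bexI[of _ d]) (auto simp: has_cycle_def)
next
  assume "\<exists>z\<in>S. (\<forall>x\<in>S - {z}. r x z) \<and> has_cycle r (S - {z})"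
  then show "has_sunk_cycle r S" unfolding has_cycle_def has_sunk_cycle_def by blast
qed

text \<open>Letting the sink run through the four vertices gives the four disjuncts of
  \<open>sink4\<close>; the equations \<open>flip\<close> bring every arc into the orientation
  recorded by the bits.\<close>

lemma has_sunk_cycle_quadruple:
  assumes r: "tour_on r {a, b, c, d}" and d: "distinct [a, b, c, d]"
  shows "has_sunk_cycle r {a, b, c, d} \<longleftrightarrow> sink4 (r a b) (r a c) (r b c) (r a d) (r b d) (r c d)"
proof -
  have D: "{a, b, c, d} - {a} = {b, c, d}" "{a, b, c, d} - {b} = {a, c, d}"
    "{a, b, c, d} - {c} = {a, b, d}" "{a, b, c, d} - {d} = {a, b, c}" using d by auto
  have C: "has_cycle r {b, c, d} = cyc3 (r b c) (r b d) (r c d)"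
    "has_cycle r {a, c, d} = cyc3 (r a c) (r a d) (r c d)"
    "has_cycle r {a, b, d} = cyc3 (r a b) (r a d) (r b d)"
    "has_cycle r {a, b, c} = cyc3 (r a b) (r a c) (r b c)"
    using d by (intro has_cycle_triple tour_on_subset[OF r]; auto)+
  have flip: "r b a = (\<not> r a b)" "r c a = (\<not> r a c)" "r c b = (\<not> r b c)"
    "r d a = (\<not> r a d)" "r d b = (\<not> r b d)" "r d c = (\<not> r c d)"
    using r d unfolding tour_on_def by auto
  have "card {a, b, c, d} = 4" using d by simp
  from has_sunk_cycle_iff_sink[OF r this] show ?thesis
    unfolding bex_simps ball_simps D C flip sink4_def
    by (cases "r a b"; cases "r a c"; cases "r b c"; cases "r a d"; cases "r b d"; cases "r c d";
      simp add: flip)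
qed

lemma has_cycle_image:
  assumes "\<And>x y. x \<in> K \<Longrightarrow> y \<in> K \<Longrightarrow> r x y \<longleftrightarrow> s (f x) (f y)"
  shows "has_cycle s (f ` K) \<longleftrightarrow> has_cycle r K"
  using assms by (auto simp: has_cycle_def)

lemma has_sunk_cycle_image:
  assumes "\<And>x y. x \<in> K \<Longrightarrow> y \<in> K \<Longrightarrow> r x y \<longleftrightarrow> s (f x) (f y)"
  shows "has_sunk_cycle s (f ` K) \<longleftrightarrow> has_sunk_cycle r K"
  using assms by (auto simp: has_sunk_cycle_def)

text \<open>Two distinct vertices with the same image are joined by an arc of \<open>r\<close>,
  which would become a loop of \<open>s\<close>.\<close>

lemma tour_on_iso_inj:
  assumes "tour_on r X" "\<And>x. x \<in> X \<Longrightarrow> \<not> s (f x) (f x)"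
    and "\<And>x y. x \<in> X \<Longrightarrow> y \<in> X \<Longrightarrow> r x y \<longleftrightarrow> s (f x) (f y)"
  shows "inj_on f X"
proof (rule inj_onI, rule ccontr)
  fix x y assume xy: "x \<in> X" "y \<in> X" "f x = f y" "x \<noteq> y"
  then have "r x y \<or> r y x" using assms(1) by (auto simp: tour_on_def)
  then show False using assms(2,3) xy by metis
qed

text \<open>The new vertex goes in front of the first path vertex that it beats, or to the end. The
  clause on \<open>hd ys\<close> strengthens the induction: a vertex \<open>y\<close> not beaten by
  \<open>x\<close> beats \<open>x\<close> and precedes \<open>hd xs\<close>, so it can be put back
  in front of \<open>ys\<close> in either case.\<close>

lemma insert_into_path:
  assumes "successively r xs" "distinct xs" "x \<notin> set xs" "tour_on r (insert x (set xs))"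
  shows "\<exists>ys. successively r ys \<and> distinct ys \<and> set ys = insert x (set xs) \<and>
    ys \<noteq> [] \<and> (hd ys = x \<or> xs \<noteq> [] \<and> hd ys = hd xs)"
  using assms
proof (induction xs)
  case Nil
  then show ?case by (intro exI[of _ "[x]"]) simp
next
  case (Cons y xs)
  show ?case
  proof (cases "r x y")
    case True
    then show ?thesis using Cons.prems by (intro exI[of _ "x # y # xs"]) auto
  next
    case False
    then have yx: "r y x" using Cons.prems by (auto simp: tour_on_def)
    have "tour_on r (insert x (set xs))" by (rule tour_on_subset[OF Cons.prems(4)]) auto
    then obtain ys where ys: "successively r ys" "distinct ys" "set ys = insert x (set xs)" "ys \<noteq> []"
      "hd ys = x \<or> xs \<noteq> [] \<and> hd ys = hd xs"
      using Cons.IH Cons.prems by (auto simp: successively_Cons)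
    then show ?thesis using yx Cons.prems by (intro exI[of _ "y # ys"]) (auto simp: successively_Cons)
  qed
qed

text \<open>Redei's theorem, by inserting the vertices one at a time.\<close>

lemma hamiltonian_path:
  assumes "finite X" "tour_on r X"
  shows "\<exists>xs. successively r xs \<and> distinct xs \<and> set xs = X"
  using assms
proof (induction X)
  case empty
  show ?case by (intro exI[of _ "[]"]) simp
next
  case (insert x X)
  then obtain xs where "successively r xs" "distinct xs" "set xs = X"
    using tour_on_subset[of r "insert x X" X] by blast
  then show ?case using insert_into_path[of r xs x] insert by blast
qed

text \<open>Listing \<open>X\<close> along a Hamiltonian path of \<open>r\<close> turns four arcs of
  \<open>r\<close> into the constant \<open>True\<close>, which is the situation of the exhaustive
  check; \<open>s\<close> is arbitrary in this labelling. The isomorphism found on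
  \<open>vtx\<close> is carried back to \<open>X\<close>.\<close>

lemma iso_five:
  assumes X: "card X = 5" and r: "tour_on r X" and s: "tour_on s X"
    and cyc: "\<And>K. K \<subseteq> X \<Longrightarrow> card K = 3 \<Longrightarrow> has_cycle r K = has_cycle s K"
    and sunk: "\<And>K. K \<subseteq> X \<Longrightarrow> card K = 4 \<Longrightarrow> has_sunk_cycle r K = has_sunk_cycle s K"
  shows "\<exists>f. bij_betw f X X \<and> (\<forall>x\<in>X. \<forall>y\<in>X. r x y \<longleftrightarrow> s (f x) (f y))"
proof -
  have fin: "finite X" using X by (simp add: card_ge_0_finite)
  then obtain xs where xs: "successively r xs" "distinct xs" "set xs = X"
    using hamiltonian_path r by blast
  then have "length xs = 5" using X distinct_card by fastforce
  then obtain a b c d e where abcde: "xs = [a, b, c, d, e]"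
    by (auto simp: numeral_eq_Suc length_Suc_conv)
  have Xeq: "X = {a, b, c, d, e}" and dist: "distinct [a, b, c, d, e]" using xs abcde by auto
  have path: "r a b = True" "r b c = True" "r c d = True" "r d e = True" using xs abcde by auto
  define h where "h = case_vtx a b c d e"
  have h: "h V0 = a" "h V1 = b" "h V2 = c" "h V3 = d" "h V4 = e" by (simp_all add: h_def)
  have hX: "range h = X"
    unfolding UNIV_vtx by (simp add: h Xeq)
  have injh: "inj h"
    using dist by (auto simp: inj_def h_def split: vtx.splits)
  \<comment> \<open>The same labelling \<open>h\<close> serves both tournaments, hence the general
    \<open>t\<close>.\<close>
  have adj: "adj (t a b) (t a c) (t b c) (t a d) (t b d) (t c d) (t a e) (t b e) (t c e) (t d e)
      = (\<lambda>x y. t (h x) (h y))" if "tour_on t X" for t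
  proof (intro ext)
    have irrefl: "\<not> t a a" "\<not> t b b" "\<not> t c c" "\<not> t d d" "\<not> t e e"
      by (rule tour_on_irrefl[OF that]; simp add: Xeq)+
    have flip: "t b a = (\<not> t a b)" "t c a = (\<not> t a c)"
      "t c b = (\<not> t b c)" "t d a = (\<not> t a d)" "t d b = (\<not> t b d)" "t d c = (\<not> t c d)"
      "t e a = (\<not> t a e)" "t e b = (\<not> t b e)" "t e c = (\<not> t c e)" "t e d = (\<not> t d e)"
      by (rule tour_on_flip[OF that]; use dist in \<open>simp add: Xeq\<close>)+
    show "adj (t a b) (t a c) (t b c) (t a d) (t b d) (t c d) (t a e) (t b e) (t c e) (t d e) x y
      = t (h x) (h y)" for x y
      by (cases x; cases y; simp add: h irrefl flip)
  qed
  have cyc': "cyc3 (r x y) (r x z) (r y z) = cyc3 (s x y) (s x z) (s y z)"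
    if "{x, y, z} \<subseteq> X" "distinct [x, y, z]" for x y z
    using cyc[of "{x, y, z}"] that has_cycle_triple[of r x y z] has_cycle_triple[of s x y z]
      tour_on_subset[OF r that(1)] tour_on_subset[OF s that(1)] by simp
  have sunk': "sink4 (r w x) (r w y) (r x y) (r w z) (r x z) (r y z)
      = sink4 (s w x) (s w y) (s x y) (s w z) (s x z) (s y z)"
    if "{w, x, y, z} \<subseteq> X" "distinct [w, x, y, z]" for w x y z
    using sunk[of "{w, x, y, z}"] that has_sunk_cycle_quadruple[of r w x y z]
      has_sunk_cycle_quadruple[of s w x y z] tour_on_subset[OF r that(1)] tour_on_subset[OF s that(1)]
    by simp
  have cycs: "cyc3 (r a b) (r a c) (r b c) = cyc3 (s a b) (s a c) (s b c)"
    "cyc3 (r a b) (r a d) (r b d) = cyc3 (s a b) (s a d) (s b d)"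
    "cyc3 (r a c) (r a d) (r c d) = cyc3 (s a c) (s a d) (s c d)"
    "cyc3 (r b c) (r b d) (r c d) = cyc3 (s b c) (s b d) (s c d)"
    "cyc3 (r a b) (r a e) (r b e) = cyc3 (s a b) (s a e) (s b e)"
    "cyc3 (r a c) (r a e) (r c e) = cyc3 (s a c) (s a e) (s c e)"
    "cyc3 (r b c) (r b e) (r c e) = cyc3 (s b c) (s b e) (s c e)"
    "cyc3 (r a d) (r a e) (r d e) = cyc3 (s a d) (s a e) (s d e)"
    "cyc3 (r b d) (r b e) (r d e) = cyc3 (s b d) (s b e) (s d e)"
    "cyc3 (r c d) (r c e) (r d e) = cyc3 (s c d) (s c e) (s d e)"
    by (rule cyc'; use dist in \<open>simp add: Xeq\<close>)+
  have sunks: "sink4 (r a b) (r a c) (r b c) (r a d) (r b d) (r c d) = sink4 (s a b) (s a c) (s b c) (s a d) (s b d) (s c d)"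
    "sink4 (r a b) (r a c) (r b c) (r a e) (r b e) (r c e) = sink4 (s a b) (s a c) (s b c) (s a e) (s b e) (s c e)"
    "sink4 (r a b) (r a d) (r b d) (r a e) (r b e) (r d e) = sink4 (s a b) (s a d) (s b d) (s a e) (s b e) (s d e)"
    "sink4 (r a c) (r a d) (r c d) (r a e) (r c e) (r d e) = sink4 (s a c) (s a d) (s c d) (s a e) (s c e) (s d e)"
    "sink4 (r b c) (r b d) (r c d) (r b e) (r c e) (r d e) = sink4 (s b c) (s b d) (s c d) (s b e) (s c e) (s d e)"
    by (rule sunk'; use dist in \<open>simp add: Xeq\<close>)+
  have "iso5 (adj (r a b) (r a c) (r b c) (r a d) (r b d) (r c d) (r a e) (r b e) (r c e) (r d e))
     (adj (s a b) (s a c) (s b c) (s a d) (s b d) (s c d) (s a e) (s b e) (s c e) (s d e))"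
    using cycs sunks unfolding path by (intro path5_determinedD[OF path5_determined])
  then have "iso5 (\<lambda>x y. r (h x) (h y)) (\<lambda>x y. s (h x) (h y))"
    by (simp only: adj[OF r] adj[OF s])
  then obtain g where g: "\<And>x y. r (h x) (h y) = s (h (g x)) (h (g y))"
    using iso5_imp[of "\<lambda>x y. r (h x) (h y)" "\<lambda>x y. s (h x) (h y)"] tour_on_irrefl[OF r] tour_on_irrefl[OF s] hX
    by (metis rangeI)
  \<comment> \<open>Conjugation by the labelling carries \<open>g\<close> from \<open>vtx\<close> to
    \<open>X\<close>.\<close>
  define f where "f = h \<circ> g \<circ> inv h"
  have iso: "r x y = s (f x) (f y)" if "x \<in> X" "y \<in> X" for x y
  proof -
    obtain u v where "x = h u" "y = h v" using \<open>x \<in> X\<close> \<open>y \<in> X\<close> hX by (metis imageE)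
    then show ?thesis using g[of u v] injh by (simp add: f_def)
  qed
  have fX: "f ` X \<subseteq> X" using hX by (auto simp: f_def)
  have "inj_on f X"
    using tour_on_iso_inj[of r X s f] r iso fX tour_on_irrefl[OF s] by blast
  then have "bij_betw f X X"
    using fX fin by (simp add: bij_betw_def endo_inj_surj)
  then show ?thesis using iso by blast
qed

section \<open>From five vertices down to four\<close>

lemma has_cycle_card:
  assumes "has_cycle r K" "tour_on r K" "finite K"
  shows "3 \<le> card K"
proof -
  obtain a b c where abc: "a \<in> K" "b \<in> K" "c \<in> K" "r a b" "r b c" "r c a"
    using assms(1) unfolding has_cycle_def by blast
  then have "distinct [a, b, c]" using assms(2) by (auto simp: tour_on_def)
  then have "card {a, b, c} = 3" by simp
  moreover have "{a, b, c} \<subseteq> K" using abc by simp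
  ultimately show ?thesis using card_mono[OF assms(3)] by metis
qed

lemma has_sunk_cycle_card:
  assumes "has_sunk_cycle r K" "tour_on r K" "finite K"
  shows "4 \<le> card K"
proof -
  obtain a b c d where abcd: "{a, b, c, d} \<subseteq> K" "distinct [a, b, c, d]"
    by (rule has_sunk_cycle_obtain[OF assms(1,2)])
  then have "card {a, b, c, d} = 4" by simp
  then show ?thesis using card_mono[OF assms(3) abcd(1)] by simp
qed

text \<open>
  Four vertices are reduced to five by adding a common sink, which every isomorphism must fix.
\<close>

definition add_sink :: "('a \<Rightarrow> 'a \<Rightarrow> bool) \<Rightarrow> 'a option \<Rightarrow> 'a option \<Rightarrow> bool" where
  "add_sink r u v = (case u of None \<Rightarrow> False | Some x \<Rightarrow> (case v of None \<Rightarrow> True | Some y \<Rightarrow> r x y))"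

lemma add_sink_simps [simp]:
  "\<not> add_sink r None v" "add_sink r (Some x) None" "add_sink r (Some x) (Some y) = r x y"
  by (simp_all add: add_sink_def)

lemma bex_option: "(\<exists>u\<in>K. P u) \<longleftrightarrow> (None \<in> K \<and> P None) \<or> (\<exists>x\<in>Some -` K. P (Some x))"
  by (metis not_None_eq vimage_eq)

lemma has_cycle_add_sink: "has_cycle (add_sink r) K \<longleftrightarrow> has_cycle r (Some -` K)"
  unfolding has_cycle_def bex_option[of K] by simp

text \<open>\<open>None\<close> has no outgoing arc, so it can occur only as the sink; then any
  3-cycle of \<open>r\<close> in the trace of \<open>K\<close> completes it.\<close>

lemma has_sunk_cycle_add_sink:
  "has_sunk_cycle (add_sink r) K \<longleftrightarrow>
    has_sunk_cycle r (Some -` K) \<or> None \<in> K \<and> has_cycle r (Some -` K)"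
  unfolding has_sunk_cycle_def has_cycle_def bex_option[of K] by (simp, blast)

lemma iso_four:
  assumes X: "card X = 4" and r: "tour_on r X" and s: "tour_on s X"
    and cyc: "\<And>K. K \<subseteq> X \<Longrightarrow> card K = 3 \<Longrightarrow> has_cycle r K = has_cycle s K"
    and sunk: "has_sunk_cycle r X = has_sunk_cycle s X"
  shows "\<exists>f. bij_betw f X X \<and> (\<forall>x\<in>X. \<forall>y\<in>X. r x y \<longleftrightarrow> s (f x) (f y))"
proof -
  have fin: "finite X" using X by (simp add: card_ge_0_finite)
  let ?X = "insert None (Some ` X)"
  have tour: "tour_on (add_sink t) ?X" if "tour_on t X" for t
    using that unfolding tour_on_def by simp
  have card: "card K = card (Some -` K) + (if None \<in> K then 1 else 0)" if "K \<subseteq> ?X" for K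
  proof -
    have "finite K" using that fin finite_subset by blast
    moreover have K: "K - {None} = Some ` (Some -` K)" by (auto simp: image_iff)
    have "card (Some -` K) = card (K - {None})"
      using card_image[of Some "Some -` K"] K by simp
    ultimately show ?thesis using card_Suc_Diff1[of K None] by auto
  qed
  have sub: "Some -` K \<subseteq> X" if "K \<subseteq> ?X" for K using that by auto
  \<comment> \<open>A triple containing \<open>None\<close> leaves only two vertices of
    \<open>X\<close>, which carry no cycle in either tournament; hence the bound instead of
    equality.\<close>
  have cyc': "has_cycle r K = has_cycle s K" if "K \<subseteq> X" "card K \<le> 3" for K
  proof (cases "card K = 3")
    case True
    then show ?thesis using cyc that(1) by blast
  next
    case False
    then have "\<not> has_cycle t K" if "tour_on t X" for t
      using has_cycle_card[of t K] tour_on_subset[OF that \<open>K \<subseteq> X\<close>] finite_subset[OF \<open>K \<subseteq> X\<close> fin]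
        \<open>card K \<le> 3\<close> by linarith
    then show ?thesis using r s by blast
  qed
  have sunk': "has_sunk_cycle r K = has_sunk_cycle s K" if "K \<subseteq> X" for K
  proof (cases "card K = 4")
    case True
    then have "K = X" using that fin X by (simp add: card_subset_eq)
    then show ?thesis using sunk by simp
  next
    case False
    then have "card K < 4" using card_mono[OF fin that] X by linarith
    then have "\<not> has_sunk_cycle t K" if "tour_on t X" for t
      using has_sunk_cycle_card[of t K] tour_on_subset[OF that \<open>K \<subseteq> X\<close>]
        finite_subset[OF \<open>K \<subseteq> X\<close> fin] by linarith
    then show ?thesis using r s by blast
  qed
  have "\<exists>f. bij_betw f ?X ?X \<and> (\<forall>x\<in>?X. \<forall>y\<in>?X. add_sink r x y \<longleftrightarrow> add_sink s (f x) (f y))"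
  proof (rule iso_five)
    show "card ?X = 5" using X fin by (simp add: card_image)
    show "tour_on (add_sink r) ?X" "tour_on (add_sink s) ?X" using tour r s by auto
    show "has_cycle (add_sink r) K = has_cycle (add_sink s) K" if "K \<subseteq> ?X" "card K = 3" for K
      using cyc'[OF sub[OF that(1)]] card[OF that(1)] that(2) by (simp add: has_cycle_add_sink)
    show "has_sunk_cycle (add_sink r) K = has_sunk_cycle (add_sink s) K"
      if "K \<subseteq> ?X" "card K = 4" for K
      using cyc'[OF sub[OF that(1)]] sunk'[OF sub[OF that(1)]] card[OF that(1)] that(2)
      by (cases "None \<in> K") (simp_all add: has_sunk_cycle_add_sink)
  qed
  then obtain f where f: "bij_betw f ?X ?X"
    and iso: "\<And>x y. x \<in> ?X \<Longrightarrow> y \<in> ?X \<Longrightarrow> add_sink r x y \<longleftrightarrow> add_sink s (f x) (f y)" by blast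
  have "f None = None"
  \<comment> \<open>If \<open>None\<close> had a proper image, that image would beat
    \<open>None = f u\<close>, so \<open>None\<close> would beat \<open>u\<close>, although it is a
    sink.\<close>
  proof (rule ccontr)
    assume *: "f None \<noteq> None"
    have "None \<in> f ` ?X" using bij_betw_imp_surj_on[OF f] by blast
    then obtain u where u: "u \<in> ?X" "f u = None" by (metis imageE)
    have "add_sink s (f None) (f u)" using * u(2) by auto
    then show False using iso[of None u] u by simp
  qed
  have Some: "\<exists>y\<in>X. f (Some x) = Some y" if "x \<in> X" for x
  proof -
    have "f (Some x) \<in> ?X" using bij_betw_apply[OF f, of "Some x"] that by blast
    moreover have "f (Some x) \<noteq> f None"
      using inj_onD[OF bij_betw_imp_inj_on[OF f], of "Some x" None] that by blast
    ultimately show ?thesis using \<open>f None = None\<close> by auto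
  qed
  define g where "g = (\<lambda>x. the (f (Some x)))"
  have g: "f (Some x) = Some (g x)" "g x \<in> X" if "x \<in> X" for x
    using Some[OF that] by (auto simp: g_def)
  have isog: "r x y = s (g x) (g y)" if "x \<in> X" "y \<in> X" for x y
    using iso[of "Some x" "Some y"] g that by simp
  have "inj_on g X"
    using tour_on_iso_inj[of r X s g] r isog g(2) tour_on_irrefl[OF s] by blast
  then have "bij_betw g X X"
    using g(2) fin by (simp add: bij_betw_def endo_inj_surj image_subsetI)
  then show ?thesis using isog by blast
qed

section \<open>Parity of the number of 3-cycles\<close>

lemma sink4_odd_cycles:
  "sink4 ab ac bc ad bd cd \<Longrightarrow> cyc3 ab ac bc \<noteq> (cyc3 ab ad bd \<noteq> (cyc3 ac ad cd \<noteq> cyc3 bc bd cd))"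
  unfolding sink4_def cyc3_def by argo

text \<open>Otherwise each of five quadruples on five points contains an odd number of 3-cycles, in
  fact one, whichever tournament supplies the sunk cycle. Each triple lies in two of these
  quadruples, so the five odd numbers have an even sum.\<close>

lemma ex_quadruple_without_sunk_cycle:
  assumes "5 \<le> card V" and r: "tour_on r V" and s: "tour_on s V"
    and cyc: "\<And>K. K \<subseteq> V \<Longrightarrow> card K = 3 \<Longrightarrow> has_cycle r K = has_cycle s K"
  shows "\<exists>S\<subseteq>V. card S = 4 \<and> \<not> has_sunk_cycle r S \<and> \<not> has_sunk_cycle s S"
proof (rule ccontr)
  assume *: "\<not> ?thesis"
  obtain W where W: "W \<subseteq> V" "card W = 5" using assms(1) by (metis obtain_subset_with_card_n)
  then obtain xs where xs: "distinct xs" "set xs = W"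
    by (metis card.infinite finite_distinct_list numeral_neq_zero)
  then have "length xs = 5" using W distinct_card by fastforce
  then obtain a b c d e where abcde: "xs = [a, b, c, d, e]"
    by (auto simp: numeral_eq_Suc length_Suc_conv)
  have sub: "{a, b, c, d, e} \<subseteq> V" and dist: "distinct [a, b, c, d, e]" using xs abcde W by auto
  \<comment> \<open>By \<open>cyc\<close> this also records the 3-cycles of \<open>s\<close>, so
    both tournaments give the same parity equation.\<close>
  define C where "C x y z = has_cycle r {x, y, z}" for x y z
  have odd: "C w x y \<noteq> (C w x z \<noteq> (C w y z \<noteq> C x y z))"
    if S: "{w, x, y, z} \<subseteq> V" and d: "distinct [w, x, y, z]" for w x y z
  proof -
    have "card {w, x, y, z} = 4" using d by simp
    then have "has_sunk_cycle r {w, x, y, z} \<or> has_sunk_cycle s {w, x, y, z}" using * S by blast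
    moreover have "C i j k = cyc3 (t i j) (t i k) (t j k)"
      if "tour_on t V" "\<And>K. K \<subseteq> V \<Longrightarrow> card K = 3 \<Longrightarrow> has_cycle r K = has_cycle t K"
        "{i, j, k} \<subseteq> V" "distinct [i, j, k]" for t i j k
      using has_cycle_triple[of t i j k] tour_on_subset[OF that(1,3)] that(2)[of "{i, j, k}"] that(3,4)
      by (simp add: C_def)
    then have "C w x y \<noteq> (C w x z \<noteq> (C w y z \<noteq> C x y z))"
      if "tour_on t V" "\<And>K. K \<subseteq> V \<Longrightarrow> card K = 3 \<Longrightarrow> has_cycle r K = has_cycle t K"
        "has_sunk_cycle t {w, x, y, z}" for t
      using sink4_odd_cycles[of "t w x" "t w y" "t x y" "t w z" "t x z" "t y z"]
        has_sunk_cycle_quadruple[of t w x y z] tour_on_subset[OF that(1) S] that S d by simp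
    ultimately show ?thesis using r s cyc by blast
  qed
  \<comment> \<open>The chains of \<open>\<noteq>\<close> are sums modulo 2. Each of the ten triples
    occurs in exactly two of the five, so adding them all gives a contradiction.\<close>
  have "C a b c \<noteq> (C a b d \<noteq> (C a c d \<noteq> C b c d))" "C a b c \<noteq> (C a b e \<noteq> (C a c e \<noteq> C b c e))"
    "C a b d \<noteq> (C a b e \<noteq> (C a d e \<noteq> C b d e))" "C a c d \<noteq> (C a c e \<noteq> (C a d e \<noteq> C c d e))"
    "C b c d \<noteq> (C b c e \<noteq> (C b d e \<noteq> C c d e))"
    by (rule odd; use sub dist in simp)+
  then show False by argo
qed

section \<open>Functions on subsets with vanishing sums\<close>

text \<open>Exchanging an element of \<open>A - B\<close> for one of \<open>B - A\<close> preserves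
  the value and shrinks \<open>A - B\<close> by one, until \<open>A\<close> becomes
  \<open>B\<close>.\<close>

lemma swap_invariant_imp_constant:
  assumes "finite V"
    and swap: "\<And>x y S. x \<in> V \<Longrightarrow> y \<in> V \<Longrightarrow> x \<noteq> y \<Longrightarrow> S \<subseteq> V - {x, y} \<Longrightarrow> Suc (card S) = t \<Longrightarrow>
      f (insert x S) = f (insert y S)"
  shows "A \<subseteq> V \<Longrightarrow> B \<subseteq> V \<Longrightarrow> card A = t \<Longrightarrow> card B = t \<Longrightarrow> f A = f B"
proof (induction "card (A - B)" arbitrary: A)
  case 0
  have fin: "finite A" "finite B" using 0 assms(1) finite_subset by blast+
  then have "A \<subseteq> B" using 0 by auto
  then show ?case using 0 fin by (metis card_subset_eq)
next
  case (Suc n)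
  have fin: "finite A" "finite B" using Suc.prems assms(1) finite_subset by blast+
  obtain x where x: "x \<in> A" "x \<notin> B" using Suc.hyps(2) by (metis Diff_iff card.empty ex_in_conv nat.distinct(1))
  have "\<not> B \<subseteq> A" using x fin Suc.prems by (metis card_subset_eq)
  then obtain y where y: "y \<in> B" "y \<notin> A" by blast
  let ?A = "insert y (A - {x})"
  have "?A - B = (A - B) - {x}" using y by auto
  then have "card (?A - B) = n" using Suc.hyps(2) x fin by simp
  moreover have cA: "Suc (card (A - {x})) = t" using fin x Suc.prems by (metis card_Suc_Diff1)
  then have "card ?A = t" using fin y by simp
  ultimately have "f ?A = f B" using Suc x y by (intro Suc.hyps(1)) auto
  moreover have "f (insert x (A - {x})) = f ?A"
    using x y Suc.prems cA by (intro swap) auto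
  ultimately show ?case using x by (simp add: insert_absorb)
qed

text \<open>Pascal's rule for sums. When it is used for \<open>x\<close> and \<open>y\<close> over
  the same \<open>K\<close>, the first summand cancels in the difference.\<close>

lemma sum_subsets_insert:
  fixes f :: "'a set \<Rightarrow> int"
  assumes "finite K" "x \<notin> K"
  shows "(\<Sum>S | S \<subseteq> insert x K \<and> card S = Suc t. f S) =
    (\<Sum>S | S \<subseteq> K \<and> card S = Suc t. f S) + (\<Sum>S | S \<subseteq> K \<and> card S = t. f (insert x S))"
proof -
  let ?A = "{S. S \<subseteq> K \<and> card S = Suc t}" and ?B = "{S. S \<subseteq> K \<and> card S = t}"
  have fin: "finite S" if "S \<subseteq> K" for S using that assms(1) finite_subset by blast
  have "{S. S \<subseteq> insert x K \<and> card S = Suc t} = ?A \<union> insert x ` ?B"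
  proof (intro equalityI subsetI)
    fix S assume S: "S \<in> {S. S \<subseteq> insert x K \<and> card S = Suc t}"
    show "S \<in> ?A \<union> insert x ` ?B"
    proof (cases "x \<in> S")
      case True
      then have "S = insert x (S - {x})" "S - {x} \<in> ?B" using S by auto
      then show ?thesis by blast
    qed (use S in auto)
  qed (use assms(2) fin in \<open>auto simp: card_insert_if\<close>)
  moreover have "inj_on (insert x) ?B"
    using assms(2) by (intro inj_onI) (metis (no_types, lifting) insert_ident mem_Collect_eq subsetD)
  moreover have "?A \<inter> insert x ` ?B = {}" using assms(2) by auto
  ultimately show ?thesis
    using assms(1) by (simp add: sum.union_disjoint sum.reindex)
qed

text \<open>Induction on \<open>t\<close>. Removing \<open>x\<close> and \<open>y\<close> takes two
  points from \<open>V\<close> while \<open>k\<close> and \<open>t\<close> drop by one each, so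
  \<open>k + t \<le> card V\<close> persists. The binomial conditions for the smaller parameters are
  the given ones with \<open>i\<close> shifted by one.\<close>

lemma subset_sums_zero_imp_constant_mod:
  fixes f :: "'a set \<Rightarrow> int" and p :: int
  assumes "finite V" "prime p" "t \<le> k" "k + t \<le> card V"
    and "\<And>i. 1 \<le> i \<Longrightarrow> i \<le> t \<Longrightarrow> \<not> p dvd int ((k - i) choose (t - i))"
    and "\<And>K. K \<subseteq> V \<Longrightarrow> card K = k \<Longrightarrow> p dvd (\<Sum>S | S \<subseteq> K \<and> card S = t. f S)"
    and "A \<subseteq> V" "B \<subseteq> V" "card A = t" "card B = t"
  shows "[f A = f B] (mod p)"
  using assms
proof (induction t arbitrary: k V f A B)
  case 0
  then have "A = {}" "B = {}" using finite_subset by (metis card_0_eq)+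
  then show ?case by simp
next
  case (Suc t)
  obtain l where k: "k = Suc l" using Suc.prems(3) by (cases k) auto
  have "f A mod p = f B mod p"
  proof (rule swap_invariant_imp_constant[where V = V and f = "\<lambda>S. f S mod p" and t = "Suc t"])
    fix x y S assume xy: "x \<in> V" "y \<in> V" "x \<noteq> y" and S: "S \<subseteq> V - {x, y}" "Suc (card S) = Suc t"
    let ?V = "V - {x, y}" and ?g = "\<lambda>S. f (insert x S) - f (insert y S)"
    have cardV: "card V = card ?V + 2"
      using xy Suc.prems(1) card_Diff_subset[of "{x, y}" V] card_mono[of V "{x, y}"] by simp
    have g0: "p dvd (\<Sum>S | S \<subseteq> K \<and> card S = t. ?g S)" if K: "K \<subseteq> ?V" "card K = l" for K
    proof -
      have fin: "finite K" using K Suc.prems(1) by (meson finite_Diff finite_subset)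
      have "p dvd (\<Sum>S | S \<subseteq> insert z K \<and> card S = Suc t. f S)" if "z \<in> {x, y}" for z
        using that xy K fin k by (intro Suc.prems(6)) (auto simp: card_insert_if)
      then have "p dvd (\<Sum>S | S \<subseteq> insert x K \<and> card S = Suc t. f S)
          - (\<Sum>S | S \<subseteq> insert y K \<and> card S = Suc t. f S)" by (intro dvd_diff) auto
      moreover have "x \<notin> K" "y \<notin> K" using K by auto
      ultimately show ?thesis using fin by (simp add: sum_subsets_insert sum_subtractf)
    qed
    have const: "[?g A' = ?g B'] (mod p)"
      if "A' \<subseteq> ?V" "B' \<subseteq> ?V" "card A' = t" "card B' = t" for A' B'
    proof (rule Suc.IH[of ?V l ?g])
      show "\<not> p dvd int ((l - i) choose (t - i))" if "1 \<le> i" "i \<le> t" for i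
        using Suc.prems(5)[of "Suc i"] that k by simp
    qed (use Suc.prems k cardV g0 that in auto)
    \<comment> \<open>One test set \<open>K\<close> of size \<open>l\<close> suffices:
      \<open>?g\<close> is constant modulo \<open>p\<close> on all \<open>t\<close>-subsets of
      \<open>?V\<close>, so its sum over those of \<open>K\<close> is \<open>l choose t\<close>
      times \<open>?g S\<close>. The factor \<open>l choose t\<close> is the case
      \<open>i = 1\<close> of the binomial condition.\<close>
    have "l \<le> card ?V" using Suc.prems(4) cardV k by simp
    then obtain K where K: "K \<subseteq> ?V" "card K = l" by (metis obtain_subset_with_card_n)
    have fin: "finite K" using K Suc.prems(1) by (meson finite_Diff finite_subset)
    have "[(\<Sum>S' | S' \<subseteq> K \<and> card S' = t. ?g S') = (\<Sum>S' | S' \<subseteq> K \<and> card S' = t. ?g S)] (mod p)"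
      by (intro cong_sum const) (use K S in auto)
    then have "p dvd (\<Sum>S' | S' \<subseteq> K \<and> card S' = t. ?g S)" using g0[OF K] cong_dvd_iff by blast
    then have "p dvd int (l choose t) * ?g S" using n_subsets[OF fin] K by simp
    moreover have "\<not> p dvd int (l choose t)" using Suc.prems(5)[of 1] k by simp
    ultimately have "p dvd ?g S" using Suc.prems(2) prime_dvd_mult_iff by blast
    then show "f (insert x S) mod p = f (insert y S) mod p" by (simp add: mod_eq_dvd_iff)
  qed (use Suc.prems in auto)
  then show ?case by (simp add: cong_def)
qed

section \<open>Binomial coefficients modulo \<open>p\<close>\<close>

lemma choose_two_times: "2 * (Suc n choose 2) = Suc n * n"
  by (simp add: choose_two)

lemma choose_three_times: "6 * (Suc (Suc n) choose 3) = Suc (Suc n) * Suc n * n"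
proof -
  have "3 * (Suc (Suc n) choose 3) = Suc (Suc n) * (Suc n choose 2)"
    using Suc_times_binomial_eq[of "Suc n" 2] by (simp add: numeral_eq_Suc mult.commute)
  then have "6 * (Suc (Suc n) choose 3) = Suc (Suc n) * (2 * (Suc n choose 2))" by simp
  then show ?thesis unfolding choose_two_times by (simp only: mult.assoc)
qed

text \<open>With \<open>n = k - 3\<close> the coefficients for \<open>i\<close> from 1 to 4 are
  \<open>(n + 2) choose 3\<close>, \<open>(n + 1) choose 2\<close>, \<open>n\<close> and 1. For
  \<open>p \<ge> 5\<close> no factor of the numerators is divisible by \<open>p\<close>; for
  \<open>p = 3\<close> and \<open>p = 2\<close> the denominators cancel the only factor
  \<open>p\<close> in them.\<close>

lemma not_dvd_binomials:
  fixes p k i :: nat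
  assumes p: "prime p" and k: "4 \<le> k" and i: "1 \<le> i" "i \<le> 4"
    and cases: "p \<ge> 5 \<and> \<not> [k = 1] (mod p) \<and> \<not> [k = 2] (mod p) \<and> \<not> [k = 3] (mod p) \<or>
      p = 3 \<and> 3 dvd k - 1 \<and> \<not> 9 dvd k - 1 \<or> p = 2 \<and> 4 dvd k"
  shows "\<not> p dvd (k - i) choose (4 - i)"
proof -
  define n where "n = k - 3"
  have n: "k = n + 3" using k by (simp add: n_def)
  have "k - 1 = Suc (Suc n)" "k - 2 = Suc n" using n by simp_all
  then have c3: "6 * ((k - 1) choose 3) = (n + 2) * (n + 1) * n"
    and c2: "2 * ((k - 2) choose 2) = (n + 1) * n"
    by (simp_all only: choose_three_times choose_two_times) simp_all
  have "\<not> p dvd (k - 1) choose 3 \<and> \<not> p dvd (k - 2) choose 2 \<and> \<not> p dvd n"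
    using cases
  proof (elim disjE conjE)
    assume "p \<ge> 5" "\<not> [k = 1] (mod p)" "\<not> [k = 2] (mod p)" "\<not> [k = 3] (mod p)"
    moreover have "[k = j] (mod p) \<longleftrightarrow> p dvd k - j" if "j \<le> k" for j
      using that by (rule cong_altdef_nat)
    ultimately have "\<not> p dvd n + 2" "\<not> p dvd n + 1" "\<not> p dvd n"
      using k n by (simp_all)
    then have "\<not> p dvd (n + 2) * (n + 1) * n" "\<not> p dvd (n + 1) * n"
      unfolding prime_dvd_mult_iff[OF p] by blast+
    then show ?thesis unfolding c3[symmetric] c2[symmetric] using \<open>\<not> p dvd n\<close> by auto
  next
    assume p3: "p = 3" and "3 dvd k - 1" "\<not> 9 dvd k - 1"
    \<comment> \<open>Exactly one factor 3 occurs in \<open>n + 2 = k - 1\<close>, and the 6 in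
      \<open>c3\<close> absorbs it.\<close>
    then obtain m where m: "n + 2 = 3 * m" using n by (auto simp: dvd_def)
    have "\<not> 3 dvd m" using \<open>\<not> 9 dvd k - 1\<close> m n by (auto simp: dvd_def)
    have n12: "\<not> 3 dvd n + 1" "\<not> 3 dvd n" using m by presburger+
    have "3 * (2 * ((k - 1) choose 3)) = 3 * (m * (n + 1) * n)"
      using c3 unfolding m by (simp add: mult.assoc)
    then have "2 * ((k - 1) choose 3) = m * (n + 1) * n" by simp
    moreover have "\<not> 3 dvd m * (n + 1) * n" "\<not> 3 dvd (n + 1) * n"
      using \<open>\<not> 3 dvd m\<close> n12 unfolding prime_dvd_mult_iff[OF p[unfolded p3]] by blast+
    ultimately have "\<not> 3 dvd 2 * ((k - 1) choose 3)" "\<not> 3 dvd 2 * ((k - 2) choose 2)"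
      using c2 by simp_all
    then show ?thesis using n12 p3 by (auto intro: dvd_mult)
  next
    assume p2: "p = 2" and "4 dvd k"
    then obtain j where "k = 4 * j" by (auto simp: dvd_def)
    \<comment> \<open>From \<open>k = 4 * j\<close> it follows that \<open>n + 1 = k - 2\<close> is
      twice an odd number, while \<open>n\<close> and \<open>n + 2\<close> are odd.\<close>
    then have m: "n + 1 = 2 * (2 * j - 1)" "odd (2 * j - 1)" "odd n" using n k by presburger+
    define m where "m = 2 * j - 1"
    note m = m[folded m_def]
    have "6 * ((k - 1) choose 3) = 2 * ((n + 2) * m * n)" "2 * ((k - 2) choose 2) = 2 * (m * n)"
      unfolding c3 c2 m(1) by (simp_all only: ac_simps)
    then have "3 * ((k - 1) choose 3) = (n + 2) * m * n" "(k - 2) choose 2 = m * n" by simp_all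
    moreover have "odd ((n + 2) * m * n)" "odd (m * n)" using m(2,3) by simp_all
    ultimately have "odd (3 * ((k - 1) choose 3))" "odd ((k - 2) choose 2)" by simp_all
    then show ?thesis using m(3) p2 by simp
  qed
  moreover have "i = 1 \<or> i = 2 \<or> i = 3 \<or> i = 4" using i by linarith
  ultimately show ?thesis using n p prime_gt_1_nat[OF p] by auto
qed

section \<open>Hypomorphic tournaments\<close>

text \<open>In \<open>delta_plus\<close> the vertices 0, 1, 2 form the cycle and 3 is its sink;
  conversely a sunk cycle fills the four-element set \<open>S\<close>.\<close>

lemma digraph_iso_delta_plus_iff:
  assumes "tour_on (\<lambda>x y. (x, y) \<in> parcs T) S" "card S = 4"
  shows "digraph_iso (with_proj T \<restriction> S) (with_proj delta_plus) \<longleftrightarrow>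
    has_sunk_cycle (\<lambda>x y. (x, y) \<in> parcs T) S"
proof -
  have "with_proj delta_plus \<restriction> {0, 1, 2, 3} = with_proj delta_plus"
    by (intro pre_digraph.equality) (auto simp: delta_plus_def)
  then have "digraph_iso (with_proj T \<restriction> S) (with_proj delta_plus) \<longleftrightarrow>
     (\<exists>f. bij_betw f S {0, 1, 2, 3} \<and> (\<forall>x\<in>S. \<forall>y\<in>S. (x, y) \<in> parcs T \<longleftrightarrow> (f x, f y) \<in> parcs delta_plus))"
    using digraph_iso_with_proj_iff[of T S delta_plus "{0, 1, 2, 3}"] by simp
  also have "\<dots> \<longleftrightarrow> has_sunk_cycle (\<lambda>x y. (x, y) \<in> parcs T) S"
  proof
    assume "\<exists>f. bij_betw f S {0, 1, 2, 3} \<and>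
      (\<forall>x\<in>S. \<forall>y\<in>S. (x, y) \<in> parcs T \<longleftrightarrow> (f x, f y) \<in> parcs delta_plus)"
    then obtain f where f: "f ` S = {0, 1, 2, 3}"
      "\<And>x y. x \<in> S \<Longrightarrow> y \<in> S \<Longrightarrow> (x, y) \<in> parcs T \<longleftrightarrow> (f x, f y) \<in> parcs delta_plus"
      by (auto simp: bij_betw_def)
    have "has_sunk_cycle (\<lambda>x y. (x, y) \<in> parcs delta_plus) {0, 1, 2, 3}"
      by (simp add: has_sunk_cycle_def delta_plus_def)
    then show "has_sunk_cycle (\<lambda>x y. (x, y) \<in> parcs T) S"
      using has_sunk_cycle_image[of S "\<lambda>x y. (x, y) \<in> parcs T" "\<lambda>x y. (x, y) \<in> parcs delta_plus" f] f
      by simp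
  next
    assume "has_sunk_cycle (\<lambda>x y. (x, y) \<in> parcs T) S"
    then obtain a b c d where abcd: "{a, b, c, d} \<subseteq> S" "distinct [a, b, c, d]"
      "(a, b) \<in> parcs T" "(b, c) \<in> parcs T" "(c, a) \<in> parcs T"
      "(a, d) \<in> parcs T" "(b, d) \<in> parcs T" "(c, d) \<in> parcs T"
      by (rule has_sunk_cycle_obtain[OF _ assms(1)])
    moreover have "finite S" using assms(2) by (simp add: card_ge_0_finite)
    moreover have "card {a, b, c, d} = 4" using abcd(2) by simp
    ultimately have S: "S = {a, b, c, d}" using assms(2) by (metis card_subset_eq)
    \<comment> \<open>The cycle goes to 0, 1, 2 in order; the default value 3 is the image of the
      sink \<open>d\<close>.\<close>
    define f where "f x = (if x = a then 0 else if x = b then 1 else if x = c then 2 else 3 :: nat)" for x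
    have f: "f a = 0" "f b = 1" "f c = 2" "f d = 3" using abcd(2) by (auto simp: f_def)
    have "bij_betw f S {0, 1, 2, 3}"
      using abcd(2) by (auto simp: bij_betw_def inj_on_def S f)
    moreover have "(x, x) \<notin> parcs T" if "x \<in> S" for x using tour_on_irrefl[OF assms(1) that] .
    then have "(a, a) \<notin> parcs T" "(b, b) \<notin> parcs T" "(c, c) \<notin> parcs T" "(d, d) \<notin> parcs T"
      using S by auto
    moreover have "(b, a) \<notin> parcs T" "(c, b) \<notin> parcs T" "(a, c) \<notin> parcs T"
      "(d, a) \<notin> parcs T" "(d, b) \<notin> parcs T" "(d, c) \<notin> parcs T"
      using tour_on_flip[OF assms(1)] abcd by auto
    ultimately have "bij_betw f S {0, 1, 2, 3}"
      "\<forall>x\<in>S. \<forall>y\<in>S. (x, y) \<in> parcs T \<longleftrightarrow> (f x, f y) \<in> parcs delta_plus"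
      using abcd(3-8) unfolding S by (simp_all add: f delta_plus_def)
    then show "\<exists>f. bij_betw f S {0, 1, 2, 3} \<and>
      (\<forall>x\<in>S. \<forall>y\<in>S. (x, y) \<in> parcs T \<longleftrightarrow> (f x, f y) \<in> parcs delta_plus)" by blast
  qed
  finally show ?thesis .
qed

section \<open>From digraphs to relations on their vertex sets\<close>

lemma tour_on_tournament:
  assumes "tournament T"
  shows "tour_on (\<lambda>x y. (x, y) \<in> parcs T) (pverts T)"
proof -
  interpret tournament T by (rule assms)
  show ?thesis using one_arc no_loops' unfolding tour_on_def by blast
qed

lemma d4_plus_induced:
  assumes "tour_on (\<lambda>x y. (x, y) \<in> parcs T) K"
  shows "d4_plus (with_proj T \<restriction> K) =
    card {S. S \<subseteq> K \<and> card S = 4 \<and> has_sunk_cycle (\<lambda>x y. (x, y) \<in> parcs T) S}"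
proof -
  have "(with_proj T \<restriction> K) \<restriction> S = with_proj T \<restriction> S" if "S \<subseteq> K" for S
    using that by (intro pre_digraph.equality) auto
  then have "digraph_iso ((with_proj T \<restriction> K) \<restriction> S) (with_proj delta_plus) \<longleftrightarrow>
      has_sunk_cycle (\<lambda>x y. (x, y) \<in> parcs T) S" if "S \<subseteq> K" "card S = 4" for S
    using that digraph_iso_delta_plus_iff[of T S] tour_on_subset[OF assms that(1)] by simp
  then show ?thesis unfolding d4_plus_def by (intro arg_cong[of _ _ card]) auto
qed

lemma hypomorphic_iff:
  "hypomorphic h T T' \<longleftrightarrow> pverts T = pverts T' \<and>
    (\<forall>K. K \<subseteq> pverts T \<and> card K = h \<longrightarrow>
      (\<exists>f. bij_betw f K K \<and> (\<forall>x\<in>K. \<forall>y\<in>K. (x, y) \<in> parcs T \<longleftrightarrow> (f x, f y) \<in> parcs T')))"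
  unfolding hypomorphic_def digraph_iso_with_proj_iff ..

text \<open>The constructions below yield isomorphisms from \<open>T\<close> to \<open>T'\<close>,
  whereas the conclusions are stated for \<open>T'\<close> and \<open>T\<close>; inverse maps bridge
  this.\<close>

lemma hypomorphic_sym:
  assumes "hypomorphic h T T'"
  shows "hypomorphic h T' T"
  unfolding hypomorphic_iff
proof (intro conjI allI impI)
  show "pverts T' = pverts T" using assms by (simp add: hypomorphic_iff)
  fix K assume "K \<subseteq> pverts T' \<and> card K = h"
  then obtain f where f: "bij_betw f K K"
    "\<And>x y. x \<in> K \<Longrightarrow> y \<in> K \<Longrightarrow> (x, y) \<in> parcs T \<longleftrightarrow> (f x, f y) \<in> parcs T'"
    using assms unfolding hypomorphic_iff by metis
  let ?g = "inv_into K f"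
  have g: "bij_betw ?g K K" using f(1) by (rule bij_betw_inv_into)
  have "(x, y) \<in> parcs T' \<longleftrightarrow> (?g x, ?g y) \<in> parcs T" if "x \<in> K" "y \<in> K" for x y
    using f(2)[of "?g x" "?g y"] g that bij_betw_inv_into_right[OF f(1)] by (simp add: bij_betw_apply)
  then show "\<exists>f. bij_betw f K K \<and> (\<forall>x\<in>K. \<forall>y\<in>K. (x, y) \<in> parcs T' \<longleftrightarrow> (f x, f y) \<in> parcs T)"
    using g by blast
qed

lemma hypomorphic_3_has_cycle:
  assumes "hypomorphic 3 T T'" "K \<subseteq> pverts T" "card K = 3"
  shows "has_cycle (\<lambda>x y. (x, y) \<in> parcs T) K = has_cycle (\<lambda>x y. (x, y) \<in> parcs T') K"
proof -
  obtain f where "f ` K = K"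
    "\<And>x y. x \<in> K \<Longrightarrow> y \<in> K \<Longrightarrow> (x, y) \<in> parcs T \<longleftrightarrow> (f x, f y) \<in> parcs T'"
    using assms unfolding hypomorphic_iff bij_betw_def by metis
  then show ?thesis
    using has_cycle_image[of K "\<lambda>x y. (x, y) \<in> parcs T" "\<lambda>x y. (x, y) \<in> parcs T'" f] by simp
qed

lemma sunk_cycles_determine_upto_5:
  assumes T: "tournament T" and T': "tournament T'" and hyp: "upto_hypomorphic 3 T T'"
    and sunk: "\<And>S. S \<subseteq> pverts T \<Longrightarrow> card S = 4 \<Longrightarrow>
      has_sunk_cycle (\<lambda>x y. (x, y) \<in> parcs T) S = has_sunk_cycle (\<lambda>x y. (x, y) \<in> parcs T') S"
  shows "upto_hypomorphic 5 T' T"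
  unfolding upto_hypomorphic_def
proof (intro allI impI)
  fix h :: nat assume "h \<le> 5"
  have V: "pverts T = pverts T'" using hyp by (auto simp: upto_hypomorphic_def hypomorphic_iff)
  have tour: "tour_on (\<lambda>x y. (x, y) \<in> parcs T) K" "tour_on (\<lambda>x y. (x, y) \<in> parcs T') K"
    if "K \<subseteq> pverts T" for K
    using that tour_on_subset tour_on_tournament T T' V by metis+
  have cyc: "has_cycle (\<lambda>x y. (x, y) \<in> parcs T) K = has_cycle (\<lambda>x y. (x, y) \<in> parcs T') K"
    if "K \<subseteq> pverts T" "card K = 3" for K
    using hypomorphic_3_has_cycle[OF _ that] hyp by (simp add: upto_hypomorphic_def)
  have "hypomorphic h T T'"
  proof -
    consider "h \<le> 3" | "h = 4" | "h = 5" using \<open>h \<le> 5\<close> by linarith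
    then show ?thesis
    proof cases
      case 1
      then show ?thesis using hyp by (simp add: upto_hypomorphic_def)
    next
      case 2
      then show ?thesis unfolding hypomorphic_iff
        using V tour cyc sunk by (intro conjI allI impI iso_four) auto
    next
      case 3
      then show ?thesis unfolding hypomorphic_iff
        using V tour cyc sunk by (intro conjI allI impI iso_five) auto
    qed
  qed
  then show "hypomorphic h T' T" by (rule hypomorphic_sym)
qed

text \<open>The common core of all cases. For \<open>p = 2\<close> the arithmetic asks only for
  \<open>4 dvd k\<close>, which covers multiples of 8 as well.\<close>

lemma d4_plus_cong_imp_upto_5:
  fixes T T' :: "'a pair_pre_digraph" and p k :: nat
  assumes T: "tournament T" and T': "tournament T'" and hyp: "upto_hypomorphic 3 T T'"
    and p: "prime p" and k: "4 \<le> k" "k + 4 \<le> card (pverts T)"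
    and cases: "p \<ge> 5 \<and> \<not> [k = 1] (mod p) \<and> \<not> [k = 2] (mod p) \<and> \<not> [k = 3] (mod p) \<or>
      p = 3 \<and> 3 dvd k - 1 \<and> \<not> 9 dvd k - 1 \<or> p = 2 \<and> 4 dvd k"
    and d4: "\<And>K. K \<subseteq> pverts T \<Longrightarrow> card K = k \<Longrightarrow>
      [d4_plus (with_proj T \<restriction> K) = d4_plus (with_proj T' \<restriction> K)] (mod p)"
  shows "upto_hypomorphic 5 T' T"
proof (rule sunk_cycles_determine_upto_5[OF T T' hyp])
  let ?V = "pverts T"
  let ?r = "\<lambda>x y. (x, y) \<in> parcs T" and ?s = "\<lambda>x y. (x, y) \<in> parcs T'"
  define f where "f S = (of_bool (has_sunk_cycle ?r S) - of_bool (has_sunk_cycle ?s S) :: int)" for S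
  have V: "?V = pverts T'" using hyp by (auto simp: upto_hypomorphic_def hypomorphic_iff)
  have fin: "finite ?V" using k by (simp add: card_ge_0_finite)
  have r: "tour_on ?r ?V" and s: "tour_on ?s ?V" using tour_on_tournament T T' V by metis+
  have sum: "int p dvd (\<Sum>S | S \<subseteq> K \<and> card S = 4. f S)" if K: "K \<subseteq> ?V" "card K = k" for K
  proof -
    have finK: "finite {S. S \<subseteq> K \<and> card S = 4}" using finite_subset[OF K(1) fin] by simp
    have "int (d4_plus (with_proj U \<restriction> K)) =
        (\<Sum>S | S \<subseteq> K \<and> card S = 4. of_bool (has_sunk_cycle (\<lambda>x y. (x, y) \<in> parcs U) S))"
      if "tour_on (\<lambda>x y. (x, y) \<in> parcs U) ?V" for U
      using d4_plus_induced[OF tour_on_subset[OF that K(1)]] finK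
      by (simp add: of_bool_def sum.If_cases Int_def conj_assoc)
    then have "(\<Sum>S | S \<subseteq> K \<and> card S = 4. f S) =
        int (d4_plus (with_proj T \<restriction> K)) - int (d4_plus (with_proj T' \<restriction> K))"
      using r s by (simp add: f_def sum_subtractf)
    then show ?thesis using d4[OF K] by (simp add: cong_iff_dvd_diff flip: cong_int_iff)
  qed
  have const: "[f A = f B] (mod int p)" if "A \<subseteq> ?V" "B \<subseteq> ?V" "card A = 4" "card B = 4" for A B
    by (rule subset_sums_zero_imp_constant_mod[where V = ?V and k = k and t = 4])
      (use fin p k sum not_dvd_binomials[OF p k(1) _ _ cases] that in auto)
  \<comment> \<open>Here both indicators are 0, so the constant value of \<open>f\<close> modulo
    \<open>p\<close> is 0.\<close>
  obtain S\<^sub>0 where S\<^sub>0: "S\<^sub>0 \<subseteq> ?V" "card S\<^sub>0 = 4" "\<not> has_sunk_cycle ?r S\<^sub>0" "\<not> has_sunk_cycle ?s S\<^sub>0"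
    using ex_quadruple_without_sunk_cycle[of ?V ?r ?s] k r s hypomorphic_3_has_cycle[of T T'] hyp
    by (auto simp: upto_hypomorphic_def)
  fix S assume S: "S \<subseteq> ?V" "card S = 4"
  \<comment> \<open>The values of \<open>f\<close> are -1, 0 and 1, so divisibility by
    \<open>p \<ge> 2\<close> means equality of the two indicators.\<close>
  have "int p dvd f S" using const[OF S(1) S\<^sub>0(1) S(2) S\<^sub>0(2)] S\<^sub>0(3,4) by (simp add: f_def cong_0_iff)
  then show "has_sunk_cycle ?r S = has_sunk_cycle ?s S"
    using prime_gt_1_nat[OF p] by (cases "has_sunk_cycle ?r S"; cases "has_sunk_cycle ?s S") (auto simp: f_def)
qed

theorem theorem5p3:
  fixes T T' :: "'a pair_pre_digraph" and V :: "'a set" and v p k :: nat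
  assumes "tournament T" and "tournament T'"
    and "pverts T = V" and "pverts T' = V" and "card V = v"
    and "upto_hypomorphic 3 T T'"
    and "prime p"
    and "4 \<le> k" and "k + 4 \<le> v"
  shows
    "((\<forall>K. K \<subseteq> V \<and> card K = k \<longrightarrow>
          d4_plus (with_proj T \<restriction> K) = d4_plus (with_proj T' \<restriction> K))
        \<longrightarrow> upto_hypomorphic 5 T' T)
     \<and>
     ((\<forall>K. K \<subseteq> V \<and> card K = k \<longrightarrow>
          [d4_plus (with_proj T \<restriction> K) = d4_plus (with_proj T' \<restriction> K)] (mod p))
        \<longrightarrow>
        (p \<ge> 5 \<and> \<not> [k = 1] (mod p) \<and> \<not> [k = 2] (mod p) \<and> \<not> [k = 3] (mod p)
           \<longrightarrow> upto_hypomorphic 5 T' T)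
        \<and>
        ((p = 3 \<and> 3 dvd k - 1 \<and> \<not> 9 dvd k - 1) \<or> (p = 2 \<and> 4 dvd k \<and> \<not> 8 dvd k)
           \<longrightarrow> upto_hypomorphic 5 T' T)
        \<and>
        (p = 2 \<and> 8 dvd k
           \<longrightarrow> upto_hypomorphic 5 T' T \<or>
             (\<forall>S. S \<subseteq> V \<and> card S = 4 \<longrightarrow>
                (digraph_iso (with_proj T \<restriction> S) (with_proj delta_plus) \<longleftrightarrow>
                 digraph_iso (with_proj T' \<restriction> S) (with_proj delta_minus)))))"
proof -
  note T = assms(1) and T' = assms(2) and hyp = assms(6)
  have k: "k + 4 \<le> card (pverts T)" using assms(3,5,9) by simp
  note main = d4_plus_cong_imp_upto_5[OF T T' hyp _ assms(8) k, unfolded assms(3)]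
  have "upto_hypomorphic 5 T' T"
    if eq: "\<forall>K. K \<subseteq> V \<and> card K = k \<longrightarrow>
      d4_plus (with_proj T \<restriction> K) = d4_plus (with_proj T' \<restriction> K)"
  proof -
    \<comment> \<open>Equality gives the congruence modulo every prime. For \<open>q > k + 1\<close>
      we have \<open>q \<ge> 5\<close>, and \<open>k\<close> is its own residue, which is at least 4
      and hence none of 1, 2, 3.\<close>
    obtain q where q: "prime q" "k + 1 < q" using bigger_prime by blast
    have "q \<ge> 5 \<and> \<not> [k = 1] (mod q) \<and> \<not> [k = 2] (mod q) \<and> \<not> [k = 3] (mod q)"
      using q(2) assms(8) by (simp add: cong_def)
    then show ?thesis using eq by (intro main[OF q(1)] disjI1) simp_all
  qed
  moreover have "upto_hypomorphic 5 T' T"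
    if "\<forall>K. K \<subseteq> V \<and> card K = k \<longrightarrow>
        [d4_plus (with_proj T \<restriction> K) = d4_plus (with_proj T' \<restriction> K)] (mod p)"
      and "p \<ge> 5 \<and> \<not> [k = 1] (mod p) \<and> \<not> [k = 2] (mod p) \<and> \<not> [k = 3] (mod p) \<or>
        p = 3 \<and> 3 dvd k - 1 \<and> \<not> 9 dvd k - 1 \<or> p = 2 \<and> 4 dvd k"
    using main[OF assms(7) that(2)] that(1) by blast
  \<comment> \<open>This settles the case \<open>8 dvd k\<close> by its first alternative.\<close>
  moreover have "4 dvd k" if "8 dvd k" using that by presburger
  ultimately show ?thesis by blast
qed

end
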